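(* For every $\tau\in\mathbb{H}^2$, $$\theta'[\tfrac23,\tfrac13]=-\frac13\,\frac{\theta'[1,1]\,\theta^3[\frac13,\frac53]}{\theta^2[\frac23,\frac13]\,\theta[0,1]}\qquad\text{and}\qquad \theta'[\tfrac23,\tfrac53]=-\frac13\,\frac{\theta'[1,1]\,\theta^3[\frac13,\frac13]}{\theta^2[\frac23,\frac53]\,\theta[0,1]}.$$
   Context: $\mathbb{H}^2=\{\tau\in\mathbb{C} : \Im\tau>0\}$ is the upper half plane. For $\epsilon,\epsilon'\in\mathbb{R}$, $\zeta\in\mathbb{C}$, $\tau\in\mathbb{H}^2$, the theta function with characteristics is $$\theta[\epsilon,\epsilon'](\zeta,\tau)=\sum_{n\in\mathbb{Z}}\exp\left(2\pi i\left[\tfrac12\left(n+\tfrac{\epsilon}{2}\right)^2\tau+\left(n+\tfrac{\epsilon}{2}\right)\left(\zeta+\tfrac{\epsilon'}{2}\right)\right]\right).$$ Write $\theta[\epsilon,\epsilon']=\theta[\epsilon,\epsilon'](0,\tau)$ and $\theta'[\epsilon,\epsilon']=\frac{\partial}{\partial\zeta}\theta[\epsilon,\epsilon'](\zeta,\tau)\big|_{\zeta=0}$; $\theta^k[\epsilon,\epsilon']$ means the $k$-th power of $\theta[\epsilon,\epsilon']$. *)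

theory Defs
  imports "HOL-Analysis.Analysis"
begin

text \<open>
  The series converges absolutely whenever \<open>Im \<tau> > 0\<close>, so the unordered sum over all integers
  is the theta series there; outside the upper half plane the value carries no meaning.
\<close>

definition theta_char :: "real \<Rightarrow> real \<Rightarrow> complex \<Rightarrow> complex \<Rightarrow> complex" where
  "theta_char \<epsilon> \<epsilon>' \<zeta> \<tau> =
     (\<Sum>\<^sub>\<infinity>n\<in>(UNIV :: int set).
        exp (2 * of_real pi * \<i> *
          (1 / 2 * (of_int n + of_real \<epsilon> / 2)\<^sup>2 * \<tau>
           + (of_int n + of_real \<epsilon> / 2) * (\<zeta> + of_real \<epsilon>' / 2))))"

definition theta_const :: "real \<Rightarrow> real \<Rightarrow> complex \<Rightarrow> complex" where
  "theta_const \<epsilon> \<epsilon>' \<tau> = theta_char \<epsilon> \<epsilon>' 0 \<tau>"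

definition theta_deriv_const :: "real \<Rightarrow> real \<Rightarrow> complex \<Rightarrow> complex" where
  "theta_deriv_const \<epsilon> \<epsilon>' \<tau> = deriv (\<lambda>\<zeta>. theta_char \<epsilon> \<epsilon>' \<zeta> \<tau>) 0"

end

theory Submission
  imports Defs "HOL-Complex_Analysis.Complex_Analysis"
begin

text \<open>
  Write \<open>\<theta>\<close> for the odd theta function \<open>theta_char 1 1\<close>. Every \<open>theta_char \<epsilon> \<epsilon>'\<close> is, up to an
  exponential factor, a translate of \<open>\<theta>\<close> by a point \<open>p\<close>. For the characteristics \<open>(2/3, 1/3)\<close>
  and \<open>(2/3, 5/3)\<close> the points \<open>2 * p\<close> and \<open>3 * p\<close> carry, modulo 2, the characteristics
  \<open>(1/3, 5/3)\<close> respectively \<open>(1/3, 1/3)\<close> and, in both cases, \<open>(0, 1)\<close>. So the theorem is about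
  the values of \<open>\<theta>\<close> at \<open>p\<close>, \<open>2 * p\<close> and \<open>3 * p\<close>, and it follows from the identity
  \<open>\<theta> (p + u) ^ 3 * \<theta> (3 * p - u) - \<theta> (p - u) ^ 3 * \<theta> (3 * p + u) = \<theta> (2 * u) * \<theta> (2 * p) ^ 3\<close>
  by differentiating at \<open>u = 0\<close>: the derivative at \<open>3 * p\<close> disappears because
  \<open>theta_char 0 1\<close> is even, and what is left is
  \<open>3 \<theta>[2/3, \<epsilon>']\<^sup>2 \<theta>'[2/3, \<epsilon>'] \<theta>[0, 1] = \<theta>'[1, 1] \<theta>[1/3, 2 \<epsilon>' - 1] ^ 3\<close>. Bringing the
  characteristic on the right into the stated form changes the sign of the cube, whence the
  factor \<open>- 1/3\<close>.

  The identity is a case of Weierstrass's three-term relation \<open>theta_three_term\<close>. That relation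
  comes from the series alone: multiplying the series of \<open>\<theta> (x + y)\<close> and
  \<open>\<theta> (x - y)\<close> shows that the product is a minor \<open>A x * B y - B x * A y\<close>
  (\<open>theta_product_formula\<close>), and the relation is the Pluecker relation for such minors.

  Division requires that \<open>\<theta>[0, 1]\<close> and \<open>\<theta>[2/3, \<epsilon>']\<close> do not vanish. Both are, up to nonzero
  factors, values of \<open>theta_char 0 1 z \<tau>\<close> with \<open>\<bar>Im z\<bar> < Im \<tau> / 2\<close>, and
  \<open>theta_char_0_1_nonzero\<close> shows that there are no zeros in this strip: a finite form of the
  Jacobi triple product, with a polynomial identity as induction step, passes to the limit and
  exhibits the function as a convergent product of nonzero factors.
\<close>

section \<open>Convergence and holomorphy of theta series\<close>

definition theta_term :: "real \<Rightarrow> real \<Rightarrow> complex \<Rightarrow> complex \<Rightarrow> int \<Rightarrow> complex" where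
  "theta_term \<epsilon> \<epsilon>' \<zeta> \<tau> n =
     exp (2 * of_real pi * \<i> *
          (1 / 2 * (of_int n + of_real \<epsilon> / 2)\<^sup>2 * \<tau>
           + (of_int n + of_real \<epsilon> / 2) * (\<zeta> + of_real \<epsilon>' / 2)))"

lemma theta_char_eq_infsum: "theta_char \<epsilon> \<epsilon>' \<zeta> \<tau> = infsum (theta_term \<epsilon> \<epsilon>' \<zeta> \<tau>) UNIV"
  unfolding theta_char_def theta_term_def ..

lemma norm_theta_term:
  "norm (theta_term \<epsilon> \<epsilon>' \<zeta> \<tau> n) =
     exp (- (pi * Im \<tau> * (of_int n + \<epsilon> / 2)\<^sup>2 + 2 * pi * (of_int n + \<epsilon> / 2) * Im \<zeta>))"
proof -
  have "(of_int n + of_real \<epsilon> / 2 :: complex) = of_real (of_int n + \<epsilon> / 2)" by simp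
  then show ?thesis
    unfolding theta_term_def norm_exp_eq_Re
    by (simp add: power2_eq_square algebra_simps del: of_real_add)
qed

lemma summable_on_exp_minus_abs_int: "(\<lambda>n::int. exp (- \<bar>of_int n\<bar> :: real)) summable_on UNIV"
proof -
  have nat: "(\<lambda>n::nat. exp (- of_nat n :: real)) summable_on UNIV"
  proof -
    have "summable (\<lambda>n::nat. (exp (-1) :: real) ^ n)"
      by (intro summable_geometric) auto
    then have "summable (\<lambda>n::nat. exp (- of_nat n :: real))"
      by (simp flip: exp_of_nat_mult)
    then show ?thesis
      by (intro norm_summable_imp_summable_on) simp
  qed
  have "(\<lambda>n::int. exp (- \<bar>of_int n\<bar> :: real)) summable_on {0..}"
    using nat by (subst summable_on_reindex_bij_witness[where i = int and j = nat and T = UNIV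
        and h = "\<lambda>n::nat. exp (- of_nat n :: real)"]) auto
  moreover have "(\<lambda>n::int. exp (- \<bar>of_int n\<bar> :: real)) summable_on {..0}"
    using nat by (subst summable_on_reindex_bij_witness[where i = "\<lambda>n. - int n" and j = "\<lambda>n. nat (- n)" and T = UNIV
        and h = "\<lambda>n::nat. exp (- of_nat n :: real)"]) auto
  ultimately have "(\<lambda>n::int. exp (- \<bar>of_int n\<bar> :: real)) summable_on ({0..} \<union> {..0})"
    by (rule summable_on_union)
  also have "{0..} \<union> {..0} = (UNIV :: int set)" by auto
  finally show ?thesis .
qed

text \<open>
  The quadratic term beats the linear one: completing the square gives a geometric majorant that
  depends on \<open>\<zeta>\<close> only through a bound for \<open>Im \<zeta>\<close>. The uniformity makes the theta functions
  entire in \<open>\<zeta>\<close>.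
\<close>

lemma norm_theta_term_bound:
  assumes "Im \<tau> > 0"
  shows "\<exists>C. \<forall>\<zeta> n. \<bar>Im \<zeta>\<bar> \<le> R \<longrightarrow> norm (theta_term \<epsilon> \<epsilon>' \<zeta> \<tau> n) \<le> C * exp (- \<bar>of_int n\<bar>)"
proof (intro exI allI impI)
  define A where "A = pi * Im \<tau>"
  define B where "B = 2 * pi * R + 1"
  have A: "A > 0" using assms by (simp add: A_def)
  fix \<zeta> :: complex and n :: int
  assume R: "\<bar>Im \<zeta>\<bar> \<le> R"
  define x where "x = of_int n + \<epsilon> / 2"
  have "- (x * Im \<zeta>) \<le> \<bar>x\<bar> * R"
    using mult_left_mono[OF R, of "\<bar>x\<bar>"] abs_le_D2[of "x * Im \<zeta>"] by (simp add: abs_mult)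
  then have 1: "2 * pi * (- (x * Im \<zeta>)) \<le> 2 * pi * (\<bar>x\<bar> * R)"
    by (intro mult_left_mono) auto
  have "0 \<le> (2 * A * \<bar>x\<bar> - B)\<^sup>2 / (4 * A)" using A by simp
  also have "\<dots> = A * x\<^sup>2 - B * \<bar>x\<bar> + B\<^sup>2 / (4 * A)"
    using A by (simp add: field_simps power2_eq_square)
  finally have "B * \<bar>x\<bar> - A * x\<^sup>2 \<le> B\<^sup>2 / (4 * A)" by simp
  moreover have "\<bar>of_int n\<bar> \<le> \<bar>x\<bar> + \<bar>\<epsilon>\<bar> / 2" by (simp add: x_def)
  ultimately have "- (A * x\<^sup>2 + 2 * pi * x * Im \<zeta>) \<le> B\<^sup>2 / (4 * A) + \<bar>\<epsilon>\<bar> / 2 - \<bar>of_int n\<bar>"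
    using 1 by (simp add: B_def algebra_simps)
  then show "norm (theta_term \<epsilon> \<epsilon>' \<zeta> \<tau> n) \<le>
      exp (B\<^sup>2 / (4 * A) + \<bar>\<epsilon>\<bar> / 2) * exp (- \<bar>of_int n\<bar>)"
    by (simp add: norm_theta_term A_def x_def flip: exp_add)
qed

lemma abs_summable_theta_term:
  assumes "Im \<tau> > 0"
  shows "(\<lambda>n. norm (theta_term \<epsilon> \<epsilon>' \<zeta> \<tau> n)) summable_on UNIV"
proof -
  obtain C where "\<And>z n. \<bar>Im z\<bar> \<le> \<bar>Im \<zeta>\<bar> \<Longrightarrow>
      norm (theta_term \<epsilon> \<epsilon>' z \<tau> n) \<le> C * exp (- \<bar>of_int n\<bar>)"
    using norm_theta_term_bound[OF assms, of "\<bar>Im \<zeta>\<bar>" \<epsilon> \<epsilon>'] by blast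
  then have C: "norm (theta_term \<epsilon> \<epsilon>' \<zeta> \<tau> n) \<le> C * exp (- \<bar>of_int n\<bar>)" for n
    by simp
  show ?thesis
    by (rule Infinite_Sum.abs_summable_on_comparison_test'[where g = "\<lambda>n. C * exp (- \<bar>of_int n\<bar>)"])
      (use C in \<open>auto intro: summable_on_cmult_right summable_on_exp_minus_abs_int\<close>)
qed

lemma holomorphic_theta_char:
  assumes "Im \<tau> > 0"
  shows "(\<lambda>\<zeta>. theta_char \<epsilon> \<epsilon>' \<zeta> \<tau>) holomorphic_on UNIV"
proof -
  have "(\<lambda>\<zeta>. theta_char \<epsilon> \<epsilon>' \<zeta> \<tau>) field_differentiable at z" for z
  proof -
    obtain C where C: "\<And>\<zeta> n. \<bar>Im \<zeta>\<bar> \<le> \<bar>Im z\<bar> + 1 \<Longrightarrow>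
        norm (theta_term \<epsilon> \<epsilon>' \<zeta> \<tau> n) \<le> C * exp (- \<bar>of_int n\<bar>)"
      using norm_theta_term_bound[OF assms, of "\<bar>Im z\<bar> + 1" \<epsilon> \<epsilon>'] by blast
    have "norm (theta_term \<epsilon> \<epsilon>' \<zeta> \<tau> n) \<le> C * exp (- \<bar>of_int n\<bar>)" if "\<zeta> \<in> cball z 1" for \<zeta> n
    proof (rule C)
      have "\<bar>Im (\<zeta> - z)\<bar> \<le> 1"
        using that abs_Im_le_cmod[of "\<zeta> - z"] by (simp add: dist_norm norm_minus_commute)
      then show "\<bar>Im \<zeta>\<bar> \<le> \<bar>Im z\<bar> + 1" by simp
    qed
    then have lim: "uniform_limit (cball z 1) (\<lambda>N \<zeta>. \<Sum>n\<in>N. theta_term \<epsilon> \<epsilon>' \<zeta> \<tau> n)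
        (\<lambda>\<zeta>. theta_char \<epsilon> \<epsilon>' \<zeta> \<tau>) (finite_subsets_at_top UNIV)"
      unfolding theta_char_eq_infsum
      by (intro Weierstrass_m_test_general[where M = "\<lambda>n. C * exp (- \<bar>of_int n\<bar>)"]
          summable_on_cmult_right summable_on_exp_minus_abs_int)
    have "(\<lambda>\<zeta>. theta_char \<epsilon> \<epsilon>' \<zeta> \<tau>) holomorphic_on ball z 1"
      by (rule holomorphic_uniform_limit[OF _ lim])
        (auto simp: theta_term_def intro!: always_eventually continuous_intros holomorphic_intros)
    then show ?thesis
      by (rule holomorphic_on_imp_differentiable_at) auto
  qed
  then show ?thesis by (simp add: holomorphic_on_def)
qed

lemma has_field_derivative_theta_char:
  assumes "Im \<tau> > 0"
  shows "((\<lambda>\<zeta>. theta_char \<epsilon> \<epsilon>' \<zeta> \<tau>) has_field_derivative theta_deriv_const \<epsilon> \<epsilon>' \<tau>) (at 0)"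
  unfolding theta_deriv_const_def
  by (rule holomorphic_derivI[OF holomorphic_theta_char[OF assms]]) auto

section \<open>A finite Jacobi triple product\<close>

definition qpoch :: "complex \<Rightarrow> nat \<Rightarrow> complex" where
  "qpoch Q n = (\<Prod>k<n. 1 - Q ^ Suc k)"

text \<open>
  Extending the reciprocal by 0 to negative indices keeps its recurrence valid on all of \<open>\<int>\<close>: at
  index 0 the factor \<open>1 - Q powi 0\<close> vanishes. So the Laurent coefficients below need no case
  distinction at the ends of their support.
\<close>

definition inv_qpoch :: "complex \<Rightarrow> int \<Rightarrow> complex" where
  "inv_qpoch Q k = (if k < 0 then 0 else inverse (qpoch Q (nat k)))"

text \<open>
  Up to sign and the power of \<open>q\<close>, these are the Gaussian binomial coefficients
  \<open>2n choose n + j\<close> in base \<open>q\<^sup>2\<close>.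
\<close>

definition jacobi_coeff :: "complex \<Rightarrow> nat \<Rightarrow> int \<Rightarrow> complex" where
  "jacobi_coeff q n j = (- 1) powi j * q powi (j\<^sup>2) *
     (qpoch (q\<^sup>2) (2 * n) * inv_qpoch (q\<^sup>2) (int n - j) * inv_qpoch (q\<^sup>2) (int n + j))"

lemma one_minus_power_nonzero:
  fixes Q :: complex
  assumes "norm Q < 1"
  shows "1 - Q ^ Suc k \<noteq> 0"
proof
  assume "1 - Q ^ Suc k = 0"
  then have "norm Q ^ Suc k = 1" by (metis eq_iff_diff_eq_0 norm_one norm_power)
  moreover have "norm Q ^ Suc k < 1" using assms by (simp add: power_less_one_iff del: power_Suc)
  ultimately show False by simp
qed

lemma inv_qpoch_rec:
  assumes "norm Q < 1"
  shows "inv_qpoch Q (k - 1) = (1 - Q powi k) * inv_qpoch Q k"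
proof (cases "k > 0")
  case True
  then obtain m where "nat k = Suc m" by (metis gr0_conv_Suc zero_less_nat_eq)
  then have k: "k = int (Suc m)" and nat: "nat k = Suc m" "nat (k - 1) = m" by linarith+
  have "qpoch Q (Suc m) = qpoch Q m * (1 - Q ^ Suc m)" by (simp add: qpoch_def)
  moreover have "Q powi k = Q ^ Suc m" unfolding k by (rule power_int_of_nat)
  ultimately show ?thesis
    using one_minus_power_nonzero[OF assms, of m] True unfolding inv_qpoch_def nat by simp
next
  case False
  then show ?thesis by (cases "k = 0") (auto simp: inv_qpoch_def)
qed

text \<open>
  This is what multiplication by
  \<open>(1 - w * q ^ (2 * n + 1)) * (1 - q ^ (2 * n + 1) / w) = 1 + q ^ (4 * n + 2) - q ^ (2 * n + 1) * (w + 1 / w)\<close>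
  does to Laurent coefficients in \<open>w\<close>. With \<open>Q = q\<^sup>2\<close>, \<open>a = Q powi (n + 1 - j)\<close> and
  \<open>b = Q powi (n + 1 + j)\<close>, so that \<open>a * b = Q ^ (2 * n + 2)\<close>, it comes down to one
  polynomial identity in \<open>a\<close>, \<open>b\<close> and \<open>1 / Q\<close>.
\<close>

lemma jacobi_coeff_Suc:
  assumes "q \<noteq> 0" "norm q < 1"
  shows "jacobi_coeff q (Suc n) j =
     (1 + q ^ (4 * n + 2)) * jacobi_coeff q n j
      - q ^ (2 * n + 1) * (jacobi_coeff q n (j - 1) + jacobi_coeff q n (j + 1))"
proof -
  define Q where "Q = q\<^sup>2"
  have Q: "norm Q < 1" "Q \<noteq> 0"
    using assms by (auto simp: Q_def norm_power power_less_one_iff)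
  have Qpow: "Q powi k = q powi (2 * k)" for k
    by (simp add: Q_def power_int_mult power_int_numeral)
  define a b where "a = Q powi (int n + 1 - j)" and "b = Q powi (int n + 1 + j)"
  define R S where "R = inv_qpoch Q (int n + 1 - j)" and "S = inv_qpoch Q (int n + 1 + j)"
  have aQ: "Q powi (int n - j) = a / Q" and bQ: "Q powi (int n + j) = b / Q"
    using Q(2) power_int_add[of Q "int n - j" 1] power_int_add[of Q "int n + j" 1]
    by (simp_all add: a_def b_def algebra_simps)
  have r1: "inv_qpoch Q (int n - j) = (1 - a) * R" "inv_qpoch Q (int n + j) = (1 - b) * S"
    using inv_qpoch_rec[OF Q(1), of "int n + 1 - j"] inv_qpoch_rec[OF Q(1), of "int n + 1 + j"]
    by (simp_all add: a_def b_def R_def S_def algebra_simps)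
  have r2: "inv_qpoch Q (int n - (j + 1)) = (1 - a / Q) * ((1 - a) * R)"
    "inv_qpoch Q (int n + (j - 1)) = (1 - b / Q) * ((1 - b) * S)"
    using inv_qpoch_rec[OF Q(1), of "int n - j"] inv_qpoch_rec[OF Q(1), of "int n + j"]
    unfolding r1 aQ bQ by (simp_all add: diff_diff_eq add_diff_eq)
  have r3: "inv_qpoch Q (int n - (j - 1)) = R" "inv_qpoch Q (int n + (j + 1)) = S"
    by (simp_all add: R_def S_def algebra_simps)
  have r4: "inv_qpoch Q (int (Suc n) - j) = R" "inv_qpoch Q (int (Suc n) + j) = S"
    by (simp_all add: R_def S_def algebra_simps)
  define P where "P = qpoch Q (2 * n)"
  have ab: "Q ^ (2 * n + 2) = a * b" "Q ^ (2 * n + 1) = a * b / Q" "q ^ (4 * n + 2) = a * b / Q"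
  proof -
    have "a * b = Q powi (int (2 * n + 2))"
      using Q(2) by (simp add: a_def b_def algebra_simps flip: power_int_add)
    then show 1: "Q ^ (2 * n + 2) = a * b" by (simp only: power_int_of_nat)
    then show 2: "Q ^ (2 * n + 1) = a * b / Q" using Q(2) by (simp add: field_simps)
    have "4 * n + 2 = 2 * (2 * n + 1)" by simp
    then have "q ^ (4 * n + 2) = Q ^ (2 * n + 1)" by (simp only: Q_def power_mult)
    with 2 show "q ^ (4 * n + 2) = a * b / Q" by simp
  qed
  have qp: "qpoch Q (2 * Suc n) = P * (1 - a * b / Q) * (1 - a * b)"
    using ab by (simp add: qpoch_def P_def)
  have s1: "q ^ (2 * n + 1) * ((- 1) powi (j - 1) * q powi ((j - 1)\<^sup>2)) = - (a * ((- 1) powi j * q powi (j\<^sup>2)))"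
  proof -
    have "q ^ (2 * n + 1) * q powi ((j - 1)\<^sup>2) = q powi (int (2 * n + 1) + (j - 1)\<^sup>2)"
      using assms(1) by (simp only: power_int_of_nat power_int_add simp_thms)
    also have "int (2 * n + 1) + (j - 1)\<^sup>2 = 2 * (int n + 1 - j) + j\<^sup>2"
      by (simp add: power2_eq_square algebra_simps)
    also have "q powi \<dots> = a * q powi (j\<^sup>2)"
      using assms(1) by (simp only: a_def Qpow power_int_add simp_thms)
    finally show ?thesis
      by (simp add: power_int_diff mult.left_commute)
  qed
  have s2: "q ^ (2 * n + 1) * ((- 1) powi (j + 1) * q powi ((j + 1)\<^sup>2)) = - (b * ((- 1) powi j * q powi (j\<^sup>2)))"
  proof -
    have "q ^ (2 * n + 1) * q powi ((j + 1)\<^sup>2) = q powi (int (2 * n + 1) + (j + 1)\<^sup>2)"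
      using assms(1) by (simp only: power_int_of_nat power_int_add simp_thms)
    also have "int (2 * n + 1) + (j + 1)\<^sup>2 = 2 * (int n + 1 + j) + j\<^sup>2"
      by (simp add: power2_eq_square algebra_simps)
    also have "q powi \<dots> = b * q powi (j\<^sup>2)"
      using assms(1) by (simp only: b_def Qpow power_int_add simp_thms)
    finally show ?thesis
      by (simp add: power_int_add mult.left_commute)
  qed
  define s where "s = (- 1) powi j * q powi (j\<^sup>2)"
  have "(1 + q ^ (4 * n + 2)) * jacobi_coeff q n j
      - q ^ (2 * n + 1) * (jacobi_coeff q n (j - 1) + jacobi_coeff q n (j + 1))
    = (1 + a * b / Q) * (s * (P * ((1 - a) * R) * ((1 - b) * S)))
      - (q ^ (2 * n + 1) * ((- 1) powi (j - 1) * q powi ((j - 1)\<^sup>2))) * (P * R * ((1 - b / Q) * ((1 - b) * S)))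
      - (q ^ (2 * n + 1) * ((- 1) powi (j + 1) * q powi ((j + 1)\<^sup>2))) * (P * ((1 - a / Q) * ((1 - a) * R)) * S)"
    unfolding jacobi_coeff_def Q_def[symmetric] P_def[symmetric] s_def r1 r2 r3 ab(3)
    by (simp add: algebra_simps)
  also have "\<dots> = s * P * R * S *
      ((1 + a * b / Q) * (1 - a) * (1 - b) + a * (1 - b / Q) * (1 - b) + b * (1 - a / Q) * (1 - a))"
    unfolding s1 s2 s_def[symmetric]
    by (simp add: algebra_simps add_divide_distrib diff_divide_distrib)
  also have "(1 + a * b / Q) * (1 - a) * (1 - b) + a * (1 - b / Q) * (1 - b) + b * (1 - a / Q) * (1 - a)
      = (1 - a * b / Q) * (1 - a * b)"
    using Q(2) by (simp add: field_simps)
  also have "s * P * R * S * ((1 - a * b / Q) * (1 - a * b)) = jacobi_coeff q (Suc n) j"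
    unfolding jacobi_coeff_def Q_def[symmetric] qp r4 s_def by (simp add: algebra_simps)
  finally show ?thesis by simp
qed

text \<open>
  The coefficients vanish for \<open>\<bar>j\<bar> > n\<close>. Summing over all integers nevertheless turns
  multiplication by \<open>w\<close> and by \<open>1 / w\<close> into plain index shifts.
\<close>

lemma finite_jacobi_triple_product:
  assumes "q \<noteq> 0" "norm q < 1" "w \<noteq> 0"
  shows "((\<lambda>j. jacobi_coeff q n j * w powi j) has_sum
           (\<Prod>k<n. (1 - w * q ^ (2 * k + 1)) * (1 - q ^ (2 * k + 1) / w))) UNIV"
proof (induction n)
  case 0
  have "((\<lambda>j. jacobi_coeff q 0 j * w powi j) has_sum (\<Sum>j\<in>{0}. jacobi_coeff q 0 j * w powi j)) {0}"
    by (rule has_sum_finite) simp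
  also have "?this \<longleftrightarrow> ?case"
    by (rule has_sum_cong_neutral[THEN trans])
       (auto simp: jacobi_coeff_def inv_qpoch_def qpoch_def)
  finally show ?case .
next
  case (Suc n)
  define F where "F = (\<Prod>k<n. (1 - w * q ^ (2 * k + 1)) * (1 - q ^ (2 * k + 1) / w))"
  define c where "c = jacobi_coeff q n"
  have F: "((\<lambda>j. c j * w powi j) has_sum F) UNIV"
    using Suc by (simp add: c_def F_def)
  have "((\<lambda>j. c (j - 1) * w powi (j - 1)) has_sum F) UNIV"
    using F by (subst has_sum_reindex_bij_witness[of _ "\<lambda>j. j + 1" "\<lambda>j. j - 1" UNIV]) auto
  from has_sum_cmult_right[OF this, of w]
  have down: "((\<lambda>j. c (j - 1) * w powi j) has_sum w * F) UNIV"
    using assms(3) by (simp add: power_int_diff mult.left_commute)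
  have "((\<lambda>j. c (j + 1) * w powi (j + 1)) has_sum F) UNIV"
    using F by (subst has_sum_reindex_bij_witness[of _ "\<lambda>j. j - 1" "\<lambda>j. j + 1" UNIV]) auto
  from has_sum_cmult_right[OF this, of "inverse w"]
  have up: "((\<lambda>j. c (j + 1) * w powi j) has_sum inverse w * F) UNIV"
    using assms(3) by (simp add: power_int_add field_simps)
  have "((\<lambda>j. (1 + q ^ (4 * n + 2)) * (c j * w powi j)
            + (- (q ^ (2 * n + 1))) * (c (j - 1) * w powi j + c (j + 1) * w powi j)) has_sum
          ((1 + q ^ (4 * n + 2)) * F + (- (q ^ (2 * n + 1))) * (w * F + inverse w * F))) UNIV"
    by (intro has_sum_cmult_right has_sum_add F up down)
  also have "(\<lambda>j. (1 + q ^ (4 * n + 2)) * (c j * w powi j)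
            + (- (q ^ (2 * n + 1))) * (c (j - 1) * w powi j + c (j + 1) * w powi j))
          = (\<lambda>j. jacobi_coeff q (Suc n) j * w powi j)"
    unfolding jacobi_coeff_Suc[OF assms(1,2)] c_def by (simp add: algebra_simps)
  also have "(1 + q ^ (4 * n + 2)) * F + (- (q ^ (2 * n + 1))) * (w * F + inverse w * F)
      = F * ((1 - w * q ^ (2 * n + 1)) * (1 - q ^ (2 * n + 1) / w))"
  proof -
    define x where "x = q ^ (2 * n + 1)"
    have "q ^ (4 * n + 2) = x * x" by (simp add: x_def flip: power_add)
    then show ?thesis unfolding x_def[symmetric] using assms(3) by (simp add: field_simps)
  qed
  finally show ?case by (simp add: F_def)
qed

lemma qpoch_tendsto:
  assumes "norm Q < 1"
  obtains P where "P \<noteq> 0" "qpoch Q \<longlonglongrightarrow> P"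
proof
  have s: "summable (\<lambda>k. norm (- (Q ^ Suc k)))"
    unfolding norm_minus_cancel norm_power
    using assms by (subst summable_Suc_iff) (auto intro: summable_geometric)
  have nz: "- (Q ^ Suc k) \<noteq> -1" for k
    using one_minus_power_nonzero[OF assms, of k] by auto
  have conv: "convergent_prod (\<lambda>k. 1 + - (Q ^ Suc k))"
    by (rule summable_imp_convergent_prod_complex[OF s nz])
  show "prodinf (\<lambda>k. 1 + - (Q ^ Suc k)) \<noteq> 0"
    using one_minus_power_nonzero[OF assms] by (intro prodinf_nonzero conv) simp
  show "qpoch Q \<longlonglongrightarrow> prodinf (\<lambda>k. 1 + - (Q ^ Suc k))"
    using has_prod_imp_tendsto'[OF convergent_prod_has_prod[OF conv]]
    unfolding qpoch_def[abs_def] by simp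
qed

section \<open>A zero-free strip\<close>

lemma tendsto_inv_qpoch:
  assumes "P \<noteq> 0" "qpoch Q \<longlonglongrightarrow> P"
  shows "(\<lambda>n. inv_qpoch Q (int n - j)) \<longlonglongrightarrow> inverse P"
proof -
  have "filterlim (\<lambda>n. nat (int n - j)) at_top sequentially"
    unfolding filterlim_at_top eventually_sequentially
  proof (intro allI exI impI)
    fix Z n :: nat
    assume "n \<ge> nat (int Z + j)"
    then show "Z \<le> nat (int n - j)" by linarith
  qed
  then have "(\<lambda>n. inverse (qpoch Q (nat (int n - j)))) \<longlonglongrightarrow> inverse P"
    by (intro tendsto_inverse assms(1) filterlim_compose[OF assms(2)])
  moreover have "\<forall>\<^sub>F n in sequentially. inverse (qpoch Q (nat (int n - j))) = inv_qpoch Q (int n - j)"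
    using eventually_ge_at_top[of "nat j"] by eventually_elim (simp add: inv_qpoch_def)
  ultimately show ?thesis by (rule Lim_transform_eventually)
qed

text \<open>
  With \<open>q = exp (\<pi> \<i> \<tau>)\<close> and \<open>w = exp (2 \<pi> \<i> z)\<close>, the coefficients of the finite triple product
  tend to \<open>(-1) ^ j q ^ (j\<^sup>2) / P\<close>, where \<open>P\<close> is the infinite product of the \<open>1 - q ^ (2k)\<close>, and
  a constant multiple of the terms of the theta series dominates them. So the products converge to
  \<open>theta_char 0 1 z \<tau> / P\<close>. On the other hand they converge to an infinite product whose
  factors are all nonzero, because \<open>norm q < norm w < 1 / norm q\<close> in the strip; such a product is
  nonzero.
\<close>

lemma theta_char_0_1_nonzero:
  assumes \<tau>: "Im \<tau> > 0" and z: "\<bar>Im z\<bar> < Im \<tau> / 2"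
  shows "theta_char 0 1 z \<tau> \<noteq> 0"
proof -
  define q where "q = exp (of_real pi * \<i> * \<tau>)"
  define w where "w = exp (2 * of_real pi * \<i> * z)"
  have q: "q \<noteq> 0" "norm q < 1" and w: "w \<noteq> 0" using \<tau> by (simp_all add: q_def w_def)
  have Q: "norm (q\<^sup>2) < 1" using q(2) by (simp add: norm_power power_less_one_iff)
  define f where "f k = (1 - w * q ^ (2 * k + 1)) * (1 - q ^ (2 * k + 1) / w)" for k :: nat
  have term_eq: "theta_term 0 1 z \<tau> j = (- 1) powi j * q powi (j\<^sup>2) * w powi j" for j
  proof -
    have "(- 1) powi j * q powi (j\<^sup>2) * w powi j
        = exp (of_int j * (of_real pi * \<i>) + of_int (j\<^sup>2) * (of_real pi * \<i> * \<tau>)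
            + of_int j * (2 * of_real pi * \<i> * z))"
      unfolding q_def w_def exp_pi_i[symmetric] exp_power_int exp_add by (simp add: mult_ac)
    then show ?thesis
      by (simp add: theta_term_def algebra_simps power2_eq_square)
  qed
  have small: "norm (w * q ^ (2 * k + 1)) < 1" "norm (q ^ (2 * k + 1) / w) < 1" for k
  proof -
    have "norm (q ^ (2 * k + 1)) \<le> norm q ^ 1"
      unfolding norm_power using q by (intro power_decreasing) auto
    then have le: "norm (q ^ (2 * k + 1)) \<le> exp (- pi * Im \<tau>)" by (simp add: q_def)
    have nw: "norm w = exp (- 2 * pi * Im z)" by (simp add: w_def)
    have "norm (w * q ^ (2 * k + 1)) \<le> exp (- 2 * pi * Im z) * exp (- pi * Im \<tau>)"
      unfolding norm_mult nw by (intro mult_left_mono le) simp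
    also have "\<dots> = exp (2 * pi * (- Im z - Im \<tau> / 2))" by (simp add: algebra_simps flip: exp_add)
    also have "\<dots> < 1" using z by (simp add: mult_less_0_iff)
    finally show "norm (w * q ^ (2 * k + 1)) < 1" .
    have "norm (q ^ (2 * k + 1) / w) \<le> exp (- pi * Im \<tau>) / exp (- 2 * pi * Im z)"
      unfolding norm_divide nw by (intro divide_right_mono le) simp
    also have "\<dots> = exp (2 * pi * (Im z - Im \<tau> / 2))" by (simp add: algebra_simps flip: exp_diff)
    also have "\<dots> < 1" using z by (simp add: mult_less_0_iff)
    finally show "norm (q ^ (2 * k + 1) / w) < 1" .
  qed
  have f_nz: "f k \<noteq> 0" for k
  proof -
    have "1 - x \<noteq> 0" if "norm x < 1" for x :: complex using that by auto
    from this[OF small(1)] this[OF small(2)] show ?thesis unfolding f_def by simp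
  qed
  have "summable (\<lambda>k. norm (f k - 1))"
  proof (rule summable_comparison_test')
    show "summable (\<lambda>k. (norm (w + 1 / w) + 1) * norm q ^ k)"
      using q(2) by (intro summable_mult summable_geometric) simp
    fix k :: nat
    define x where "x = q ^ (2 * k + 1)"
    have "norm x = norm q ^ (2 * k + 1)" by (simp only: x_def norm_power)
    also have "\<dots> \<le> norm q ^ k" using q(2) by (intro power_decreasing) auto
    finally have x: "norm x \<le> norm q ^ k" .
    then have x1: "norm x \<le> 1" using q(2) by (meson norm_ge_zero order.trans less_imp_le power_le_one)
    have "f k - 1 = x * (x - (w + 1 / w))"
      using w by (simp add: f_def x_def field_simps)
    also have "norm \<dots> \<le> norm q ^ k * (norm (w + 1 / w) + 1)"
      unfolding norm_mult using norm_triangle_ineq4[of x "w + 1 / w"] x x1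
      by (intro mult_mono) auto
    finally show "norm (norm (f k - 1)) \<le> (norm (w + 1 / w) + 1) * norm q ^ k"
      by (simp add: mult.commute)
  qed
  then have conv: "convergent_prod (\<lambda>k. 1 + (f k - 1))"
    using f_nz by (intro summable_imp_convergent_prod_complex) (simp_all add: algebra_simps)
  then have conv: "convergent_prod f" by simp
  have F_lim: "(\<lambda>n. \<Prod>k<n. f k) \<longlonglongrightarrow> prodinf f"
    using conv by (intro has_prod_imp_tendsto' convergent_prod_has_prod)
  have L: "prodinf f \<noteq> 0" by (intro prodinf_nonzero conv f_nz)
  obtain P where P: "P \<noteq> 0" "qpoch (q\<^sup>2) \<longlonglongrightarrow> P" using qpoch_tendsto[OF Q] .
  obtain B where B: "norm (qpoch (q\<^sup>2) n) \<le> B" for n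
    using convergent_imp_Bseq[OF convergentI[OF P(2)]] unfolding Bseq_def by blast
  obtain B' where B': "norm (inverse (qpoch (q\<^sup>2) n)) \<le> B'" for n
    using convergent_imp_Bseq[OF convergentI[OF tendsto_inverse[OF P(2,1)]]] unfolding Bseq_def by blast
  have B0: "B \<ge> 0" "B' \<ge> 0" using B[of 0] B'[of 0] norm_ge_zero order.trans by blast+
  then have B'': "norm (inv_qpoch (q\<^sup>2) k) \<le> B'" for k using B' by (simp add: inv_qpoch_def)
  define s where "s n j = jacobi_coeff q n j * w powi j" for n j
  have s_eq: "s n j = theta_term 0 1 z \<tau> j *
      (qpoch (q\<^sup>2) (2 * n) * inv_qpoch (q\<^sup>2) (int n - j) * inv_qpoch (q\<^sup>2) (int n + j))" for n j
    by (simp add: s_def jacobi_coeff_def term_eq)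
  have s_bound: "norm (s n j) \<le> norm (theta_term 0 1 z \<tau> j) * (B * B' * B')" for n j
    unfolding s_eq norm_mult using B B'' B0
    by (intro mult_left_mono mult_mono) auto
  have s_lim: "(\<lambda>n. s n j) \<longlonglongrightarrow> theta_term 0 1 z \<tau> j * inverse P" for j
  proof -
    have "(\<lambda>n. qpoch (q\<^sup>2) (2 * n)) \<longlonglongrightarrow> P"
      by (rule filterlim_compose[OF P(2)]) (simp add: filterlim_subseq strict_mono_def)
    moreover have "(\<lambda>n. inv_qpoch (q\<^sup>2) (int n + j)) \<longlonglongrightarrow> inverse P"
      using tendsto_inv_qpoch[OF P, of "- j"] by simp
    ultimately have "(\<lambda>n. s n j) \<longlonglongrightarrow> theta_term 0 1 z \<tau> j * (P * inverse P * inverse P)"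
      unfolding s_eq by (intro tendsto_mult tendsto_const tendsto_inv_qpoch[OF P])
    then show ?thesis using P(1) by simp
  qed
  have int_bound: "integrable (count_space UNIV) (\<lambda>j. norm (theta_term 0 1 z \<tau> j) * (B * B' * B'))"
  proof -
    have "Infinite_Set_Sum.abs_summable_on (theta_term 0 1 z \<tau>) UNIV"
      using abs_summable_theta_term[OF \<tau>] abs_summable_equivalent by blast
    then have "integrable (count_space UNIV) (theta_term 0 1 z \<tau>)"
      by (simp add: Infinite_Set_Sum.abs_summable_on_def)
    then show ?thesis by (intro integrable_mult_left integrable_norm)
  qed
  \<comment> \<open>The theta series is read as an integral against counting measure on \<open>\<int>\<close>, where the dominated
     convergence theorem applies.\<close>
  have lim: "(\<lambda>n. integral\<^sup>L (count_space UNIV) (s n)) \<longlonglongrightarrow>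
      integral\<^sup>L (count_space UNIV) (\<lambda>j. theta_term 0 1 z \<tau> j * inverse P)"
    by (rule integral_dominated_convergence[OF _ _ int_bound]) (use s_lim s_bound in auto)
  have as_sum: "integral\<^sup>L (count_space UNIV) g = infsum g UNIV"
    if "\<And>j. norm (g j) \<le> norm (theta_term 0 1 z \<tau> j) * (B * B' * B')" for g :: "int \<Rightarrow> complex"
  proof -
    have "integrable (count_space UNIV) g"
      by (rule Bochner_Integration.integrable_bound[OF int_bound])
         (use that B0 in \<open>auto simp: abs_mult\<close>)
    then have "Infinite_Set_Sum.abs_summable_on g UNIV"
      by (simp add: Infinite_Set_Sum.abs_summable_on_def)
    from infsetsum_infsum[OF this] show ?thesis by (simp add: infsetsum_def)
  qed
  have "integral\<^sup>L (count_space UNIV) (s n) = (\<Prod>k<n. f k)" for n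
    unfolding as_sum[OF s_bound] unfolding s_def f_def
    by (rule infsumI[OF finite_jacobi_triple_product[OF q w]])
  moreover have "integral\<^sup>L (count_space UNIV) (\<lambda>j. theta_term 0 1 z \<tau> j * inverse P)
      = theta_char 0 1 z \<tau> * inverse P"
  proof -
    have "norm (theta_term 0 1 z \<tau> j * inverse P) \<le> norm (theta_term 0 1 z \<tau> j) * (B * B' * B')" for j
      by (rule LIMSEQ_le_const2[OF tendsto_norm[OF s_lim]]) (use s_bound in auto)
    from as_sum[OF this] show ?thesis
      by (simp add: infsum_cmult_left' theta_char_eq_infsum)
  qed
  ultimately have "(\<lambda>n. \<Prod>k<n. f k) \<longlonglongrightarrow> theta_char 0 1 z \<tau> * inverse P"
    using lim by (simp only:)
  then have "prodinf f = theta_char 0 1 z \<tau> * inverse P"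
    by (rule LIMSEQ_unique[OF F_lim])
  with L show ?thesis by auto
qed

section \<open>Products of theta functions and the three-term relation\<close>

lemma has_sum_int_product:
  fixes f g :: "int \<Rightarrow> complex"
  assumes f: "(\<lambda>n. norm (f n)) summable_on UNIV" and g: "(\<lambda>n. norm (g n)) summable_on UNIV"
  shows "((\<lambda>(m, n). f m * g n) has_sum infsum f UNIV * infsum g UNIV) UNIV"
proof -
  have "(\<lambda>p. norm ((\<lambda>(m, n). f m * g n) p)) summable_on UNIV \<times> UNIV"
    unfolding Infinite_Sum.abs_summable_on_Sigma_iff
    using f g by (auto simp: norm_mult infsum_cmult_right' abs_mult
        intro!: summable_on_cmult_right summable_on_cmult_left)
  then have s: "(\<lambda>(m, n). f m * g n) summable_on UNIV \<times> UNIV"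
    by (rule abs_summable_summable)
  have "infsum f UNIV * infsum g UNIV = (\<Sum>\<^sub>\<infinity>m. \<Sum>\<^sub>\<infinity>n. f m * g n)"
    by (simp add: infsum_cmult_right' infsum_cmult_left')
  also have "\<dots> = infsum (\<lambda>(m, n). f m * g n) (UNIV \<times> UNIV)"
    by (rule infsum_Sigma'_banach[OF s])
  finally show ?thesis using has_sum_infsum[OF s] by simp
qed

text \<open>
  In the double series of the left side substitute the sum and the difference of the two
  half-integral summation indices. They are integers of opposite parity, and
  \<open>m\<^sup>2 + n\<^sup>2 = ((m + n)\<^sup>2 + (m - n)\<^sup>2) / 2\<close> keeps the quadratic form diagonal; writing the new indices
  as \<open>2 * r\<close> and \<open>2 * s + 1\<close> then doubles \<open>\<tau>\<close>. The two terms on the right collect the index pairs with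
  even and with odd sum; the sign comes from the characteristic \<open>\<epsilon>' = 1\<close>.
\<close>

lemma theta_product_formula:
  assumes \<tau>: "Im \<tau> > 0"
  shows "theta_char 1 1 (x + y) \<tau> * theta_char 1 1 (x - y) \<tau> =
     theta_char 0 0 (2 * x) (2 * \<tau>) * theta_char 1 0 (2 * y) (2 * \<tau>)
     - theta_char 1 0 (2 * x) (2 * \<tau>) * theta_char 0 0 (2 * y) (2 * \<tau>)"
proof -
  define h where "h = (\<lambda>(k, l). theta_term 1 1 (x + y) \<tau> k * theta_term 1 1 (x - y) \<tau> l)"
  define A where "A z = theta_char 0 0 (2 * z) (2 * \<tau>)" for z
  define B where "B z = theta_char 1 0 (2 * z) (2 * \<tau>)" for z
  have \<tau>2: "Im (2 * \<tau>) > 0" using \<tau> by simp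
  have prod: "((\<lambda>(m, n). theta_term a b u t m * theta_term c d v t n) has_sum
      theta_char a b u t * theta_char c d v t) UNIV" if "Im t > 0" for a b u c d v t
    unfolding theta_char_eq_infsum using that by (intro has_sum_int_product abs_summable_theta_term)
  have H: "(h has_sum theta_char 1 1 (x + y) \<tau> * theta_char 1 1 (x - y) \<tau>) UNIV"
    unfolding h_def by (rule prod[OF \<tau>])
  have shift: "exp (2 * of_real pi * \<i> * (z + of_int r)) = exp (2 * of_real pi * \<i> * z)"
    "exp (2 * of_real pi * \<i> * (z + of_int r + 1 / 2)) = - exp (2 * of_real pi * \<i> * z)" for z r
  proof -
    have "exp (2 * of_real pi * \<i> * of_int r) = 1" 
      using exp_integer_2pi[of "of_int r"] by (simp add: mult_ac)
    then show "exp (2 * of_real pi * \<i> * (z + of_int r)) = exp (2 * of_real pi * \<i> * z)"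
      "exp (2 * of_real pi * \<i> * (z + of_int r + 1 / 2)) = - exp (2 * of_real pi * \<i> * z)"
      by (simp_all add: distrib_left exp_add)
  qed
  have odd_term: "h (r + s, r - s - 1) = theta_term 0 0 (2 * x) (2 * \<tau>) r * theta_term 1 0 (2 * y) (2 * \<tau>) s"
    for r s
  proof -
    have "h (r + s, r - s - 1) = exp (2 * of_real pi * \<i> *
       (((of_int r)\<^sup>2 * \<tau> + 2 * of_int r * x + (of_int s + 1 / 2)\<^sup>2 * \<tau> + (2 * of_int s + 1) * y) + of_int r))"
      unfolding h_def theta_term_def prod.case exp_add[symmetric]
      by (rule arg_cong[of _ _ exp]) (simp add: field_simps power2_eq_square)
    also have "\<dots> = theta_term 0 0 (2 * x) (2 * \<tau>) r * theta_term 1 0 (2 * y) (2 * \<tau>) s"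
      unfolding shift theta_term_def exp_add[symmetric]
      by (rule arg_cong[of _ _ exp]) (simp add: field_simps power2_eq_square)
    finally show ?thesis .
  qed
  have even_term: "h (r + s, r - s) = - (theta_term 1 0 (2 * x) (2 * \<tau>) r * theta_term 0 0 (2 * y) (2 * \<tau>) s)"
    for r s
  proof -
    have "h (r + s, r - s) = exp (2 * of_real pi * \<i> *
       (((of_int r + 1 / 2)\<^sup>2 * \<tau> + (2 * of_int r + 1) * x + (of_int s)\<^sup>2 * \<tau> + 2 * of_int s * y) + of_int r + 1 / 2))"
      unfolding h_def theta_term_def prod.case exp_add[symmetric]
      by (rule arg_cong[of _ _ exp]) (simp add: field_simps power2_eq_square)
    also have "\<dots> = - (theta_term 1 0 (2 * x) (2 * \<tau>) r * theta_term 0 0 (2 * y) (2 * \<tau>) s)"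
      unfolding shift theta_term_def exp_add[symmetric]
      by (intro arg_cong[of _ _ uminus] arg_cong[of _ _ exp]) (simp add: field_simps power2_eq_square)
    finally show ?thesis .
  qed
  have "bij_betw (\<lambda>(r, s). (r + s, r - s - 1)) (UNIV :: (int \<times> int) set) {p. odd (fst p - snd p)}"
    by (rule bij_betwI[where g = "\<lambda>(k, l). ((k + l + 1) div 2, (k - l - 1) div 2)"])
       (auto simp: split_beta prod_eq_iff elim!: oddE)
  then have "(h has_sum A x * B y) {p. odd (fst p - snd p)} \<longleftrightarrow>
      ((\<lambda>p. h (case p of (r, s) \<Rightarrow> (r + s, r - s - 1))) has_sum A x * B y) UNIV"
    by (rule has_sum_reindex_bij_betw[symmetric])
  also have "(\<lambda>p. h (case p of (r, s) \<Rightarrow> (r + s, r - s - 1)))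
      = (\<lambda>(r, s). theta_term 0 0 (2 * x) (2 * \<tau>) r * theta_term 1 0 (2 * y) (2 * \<tau>) s)"
    by (simp add: fun_eq_iff odd_term)
  also have "(\<dots> has_sum A x * B y) UNIV \<longleftrightarrow> True"
    unfolding A_def B_def by (simp add: prod[OF \<tau>2])
  finally have "(h has_sum A x * B y) {p. odd (fst p - snd p)}" by simp
  moreover have "(h has_sum - (B x * A y)) {p. even (fst p - snd p)}"
  proof -
    have "bij_betw (\<lambda>(r, s). (r + s, r - s)) (UNIV :: (int \<times> int) set) {p. even (fst p - snd p)}"
      by (rule bij_betwI[where g = "\<lambda>(k, l). ((k + l) div 2, (k - l) div 2)"])
         (auto simp: split_beta prod_eq_iff, presburger+)
    then have "(h has_sum - (B x * A y)) {p. even (fst p - snd p)} \<longleftrightarrow>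
        ((\<lambda>p. h (case p of (r, s) \<Rightarrow> (r + s, r - s))) has_sum - (B x * A y)) UNIV"
      by (rule has_sum_reindex_bij_betw[symmetric])
    also have "(\<lambda>p. h (case p of (r, s) \<Rightarrow> (r + s, r - s)))
        = (\<lambda>p. - (case p of (r, s) \<Rightarrow> theta_term 1 0 (2 * x) (2 * \<tau>) r * theta_term 0 0 (2 * y) (2 * \<tau>) s))"
      by (simp add: fun_eq_iff even_term)
    also have "(\<dots> has_sum - (B x * A y)) UNIV \<longleftrightarrow> True"
      unfolding A_def B_def has_sum_uminus by (simp add: prod[OF \<tau>2])
    finally show ?thesis by simp
  qed
  ultimately have "(h has_sum (A x * B y + - (B x * A y)))
      ({p. odd (fst p - snd p)} \<union> {p. even (fst p - snd p)})"
    by (rule has_sum_Un_disjoint) auto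
  also have "{p :: int \<times> int. odd (fst p - snd p)} \<union> {p. even (fst p - snd p)} = UNIV" by auto
  finally have "(h has_sum (A x * B y - B x * A y)) UNIV" by simp
  with H show ?thesis unfolding A_def B_def by (rule has_sum_unique)
qed

text \<open>
  By the product formula each factor \<open>\<theta> (a + b) * \<theta> (a - b)\<close> is a \<open>2 \<times> 2\<close> minor
  \<open>A a * B b - B a * A b\<close>, and so this is the Pluecker relation among the minors of a
  \<open>2 \<times> 4\<close> matrix.
\<close>

lemma theta_three_term:
  assumes \<tau>: "Im \<tau> > 0"
  defines "\<theta> \<equiv> \<lambda>z. theta_char 1 1 z \<tau>"
  shows "\<theta> (a + b) * \<theta> (a - b) * (\<theta> (c + d) * \<theta> (c - d))
       + \<theta> (b + c) * \<theta> (b - c) * (\<theta> (a + d) * \<theta> (a - d))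
       + \<theta> (c + a) * \<theta> (c - a) * (\<theta> (b + d) * \<theta> (b - d)) = 0"
  unfolding \<theta>_def theta_product_formula[OF \<tau>] by algebra

section \<open>Dependence on the characteristic\<close>

lemma theta_char_uminus:
  "theta_char \<epsilon> \<epsilon>' (- \<zeta>) \<tau> = theta_char (- \<epsilon>) (- \<epsilon>') \<zeta> \<tau>"
  unfolding theta_char_eq_infsum
proof (rule infsum_reindex_bij_witness[of _ uminus uminus])
  fix n :: int
  show "theta_term (- \<epsilon>) (- \<epsilon>') \<zeta> \<tau> (- n) = theta_term \<epsilon> \<epsilon>' (- \<zeta>) \<tau> n"
    by (simp add: theta_term_def algebra_simps power2_eq_square)
qed auto

lemma theta_char_add_2_left: "theta_char (\<epsilon> + 2) \<epsilon>' \<zeta> \<tau> = theta_char \<epsilon> \<epsilon>' \<zeta> \<tau>"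
  unfolding theta_char_eq_infsum
proof (rule infsum_reindex_bij_witness[of _ "\<lambda>n. n - 1" "\<lambda>n. n + 1"])
  fix n :: int
  show "theta_term \<epsilon> \<epsilon>' \<zeta> \<tau> (n + 1) = theta_term (\<epsilon> + 2) \<epsilon>' \<zeta> \<tau> n"
    by (simp add: theta_term_def add_divide_distrib add.assoc) (simp add: add_ac)
qed auto

lemma theta_char_eq_cmultI:
  assumes "\<And>n. theta_term a b \<zeta> \<tau> n = c * theta_term a' b' \<zeta>' \<tau>' n"
  shows "theta_char a b \<zeta> \<tau> = c * theta_char a' b' \<zeta>' \<tau>'"
  unfolding theta_char_eq_infsum by (simp add: assms infsum_cmult_right' cong: infsum_cong)

lemma theta_char_add_2_right:
  "theta_char \<epsilon> (\<epsilon>' + 2) \<zeta> \<tau> = exp (of_real (pi * \<epsilon>) * \<i>) * theta_char \<epsilon> \<epsilon>' \<zeta> \<tau>"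
proof -
  have "theta_term \<epsilon> (\<epsilon>' + 2) \<zeta> \<tau> n = exp (of_real (pi * \<epsilon>) * \<i>) * theta_term \<epsilon> \<epsilon>' \<zeta> \<tau> n" for n
  proof -
    have "exp (2 * of_real pi * \<i> * of_int n) = 1"
      using exp_integer_2pi[of "of_int n"] by (simp add: mult_ac)
    then have "exp (of_real (pi * \<epsilon>) * \<i>) * theta_term \<epsilon> \<epsilon>' \<zeta> \<tau> n
       = exp (2 * of_real pi * \<i> * of_int n) * exp (of_real (pi * \<epsilon>) * \<i>) * theta_term \<epsilon> \<epsilon>' \<zeta> \<tau> n"
      by simp
    also have "\<dots> = theta_term \<epsilon> (\<epsilon>' + 2) \<zeta> \<tau> n"
      unfolding theta_term_def exp_add[symmetric]
      by (rule arg_cong[of _ _ exp]) (simp add: field_simps)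
    finally show ?thesis ..
  qed
  then show ?thesis by (rule theta_char_eq_cmultI)
qed

text \<open>
  A change of characteristic is a translation of the argument, up to an exponential factor. In
  this way identities for \<open>theta_char 1 1\<close> become identities for all characteristics.
\<close>

lemma theta_char_shift:
  "theta_char (\<epsilon> + 2 * \<delta>) (\<epsilon>' + \<delta>') \<zeta> \<tau> =
     exp (2 * of_real pi * \<i> * ((of_real \<delta>)\<^sup>2 * \<tau> / 2 + of_real \<delta> * (\<zeta> + of_real (\<epsilon>' + \<delta>') / 2)))
     * theta_char \<epsilon> \<epsilon>' (\<zeta> + of_real \<delta>' / 2 + of_real \<delta> * \<tau>) \<tau>"
proof -
  have "theta_term (\<epsilon> + 2 * \<delta>) (\<epsilon>' + \<delta>') \<zeta> \<tau> n =
     exp (2 * of_real pi * \<i> * ((of_real \<delta>)\<^sup>2 * \<tau> / 2 + of_real \<delta> * (\<zeta> + of_real (\<epsilon>' + \<delta>') / 2)))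
     * theta_term \<epsilon> \<epsilon>' (\<zeta> + of_real \<delta>' / 2 + of_real \<delta> * \<tau>) \<tau> n" for n
    unfolding theta_term_def exp_add[symmetric]
    by (rule arg_cong[of _ _ exp]) (simp add: field_simps power2_eq_square)
  then show ?thesis by (rule theta_char_eq_cmultI)
qed

section \<open>The triplication formula\<close>

lemma theta_1_1_odd: "theta_char 1 1 (- \<zeta>) \<tau> = - theta_char 1 1 \<zeta> \<tau>"
proof -
  have "theta_char 1 1 (- \<zeta>) \<tau> = theta_char 1 (- 1) \<zeta> \<tau>"
    using theta_char_add_2_left[of "- 1" "- 1" \<zeta> \<tau>] by (simp add: theta_char_uminus)
  also have "\<dots> = - theta_char 1 1 \<zeta> \<tau>"
    using theta_char_add_2_right[of 1 "- 1" \<zeta> \<tau>] by simp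
  finally show ?thesis .
qed

text \<open>
  The three-term relation at \<open>a = p + u\<close>, \<open>b = 0\<close>, \<open>c = 2 * p\<close>, \<open>d = u - p\<close>. These values make
  the first and the third product \<open>\<theta> (p + u) ^ 3 * \<theta> (3 * p - u)\<close> and, up to sign, its
  image under \<open>u \<mapsto> - u\<close>, so that differentiation at \<open>u = 0\<close> isolates logarithmic derivatives at \<open>p\<close> and
  \<open>3 * p\<close>.
\<close>

lemma theta_1_1_triplication:
  assumes \<tau>: "Im \<tau> > 0"
  defines "\<theta> \<equiv> \<lambda>z. theta_char 1 1 z \<tau>"
  shows "\<theta> (p + u) ^ 3 * \<theta> (3 * p - u) - \<theta> (p - u) ^ 3 * \<theta> (3 * p + u) = \<theta> (2 * u) * \<theta> (2 * p) ^ 3"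
proof -
  have odd: "\<theta> (- z) = - \<theta> z" for z unfolding \<theta>_def by (rule theta_1_1_odd)
  have "\<theta> (p + u) * \<theta> (p + u) * (\<theta> (p + u) * \<theta> (3 * p - u))
      + \<theta> (2 * p) * \<theta> (- (2 * p)) * (\<theta> (2 * u) * \<theta> (2 * p))
      + \<theta> (3 * p + u) * \<theta> (p - u) * (\<theta> (- (p - u)) * \<theta> (p - u)) = 0"
    using theta_three_term[OF \<tau>, of "p + u" 0 "2 * p" "u - p"]
    by (simp add: \<theta>_def algebra_simps)
  then show ?thesis unfolding odd by algebra
qed

text \<open>
  The characteristic \<open>(1 + 2 \<delta>, 1 + \<delta>')\<close> belongs to the point \<open>p = \<delta>' / 2 + \<delta> * \<tau>\<close>, and the
  characteristics of \<open>2 * p\<close> and \<open>3 * p\<close> are \<open>(2 \<epsilon> - 1, 2 \<epsilon>' - 1)\<close> and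
  \<open>(3 \<epsilon> - 2, 3 \<epsilon>' - 2)\<close>. The exponential factors of the three translations cancel exactly.
\<close>

lemma theta_char_triplication:
  assumes \<tau>: "Im \<tau> > 0"
  shows "theta_char \<epsilon> \<epsilon>' u \<tau> ^ 3 * theta_char (3 * \<epsilon> - 2) (3 * \<epsilon>' - 2) (- u) \<tau>
       - theta_char \<epsilon> \<epsilon>' (- u) \<tau> ^ 3 * theta_char (3 * \<epsilon> - 2) (3 * \<epsilon>' - 2) u \<tau>
       = theta_char 1 1 (2 * u) \<tau> * theta_char (2 * \<epsilon> - 1) (2 * \<epsilon>' - 1) 0 \<tau> ^ 3"
proof -
  define \<delta> \<delta>' where "\<delta> = (\<epsilon> - 1) / 2" and "\<delta>' = \<epsilon>' - 1"
  define p where "p = of_real \<delta>' / 2 + of_real \<delta> * \<tau>"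
  define \<theta> where "\<theta> z = theta_char 1 1 z \<tau>" for z
  define E where "E k v = exp (2 * of_real pi * \<i> *
      ((of_real (k * \<delta>))\<^sup>2 * \<tau> / 2 + of_real (k * \<delta>) * (v + of_real (1 + k * \<delta>') / 2)))"
    for k :: real and v :: complex
  have shift: "theta_char (1 + 2 * (k * \<delta>)) (1 + k * \<delta>') v \<tau> = E k v * \<theta> (v + of_real k * p)" for k v
    unfolding theta_char_shift E_def \<theta>_def p_def by (simp add: algebra_simps)
  have chars: "\<epsilon> = 1 + 2 * (1 * \<delta>)" "\<epsilon>' = 1 + 1 * \<delta>'"
    "2 * \<epsilon> - 1 = 1 + 2 * (2 * \<delta>)" "2 * \<epsilon>' - 1 = 1 + 2 * \<delta>'"
    "3 * \<epsilon> - 2 = 1 + 2 * (3 * \<delta>)" "3 * \<epsilon>' - 2 = 1 + 3 * \<delta>'"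
    by (simp_all add: \<delta>_def \<delta>'_def field_simps)
  have e1: "theta_char \<epsilon> \<epsilon>' v \<tau> = E 1 v * \<theta> (p + v)" for v
    using shift[of 1 v] unfolding chars(1,2)[symmetric] by (simp add: add_ac)
  have e2: "theta_char (2 * \<epsilon> - 1) (2 * \<epsilon>' - 1) v \<tau> = E 2 v * \<theta> (2 * p + v)" for v
    unfolding chars(3,4) shift by (simp add: add_ac)
  have e3: "theta_char (3 * \<epsilon> - 2) (3 * \<epsilon>' - 2) v \<tau> = E 3 v * \<theta> (3 * p + v)" for v
    unfolding chars(5,6) shift by (simp add: add_ac)
  \<comment> \<open>In the exponents, the coefficients of \<open>\<tau>\<close> balance since \<open>3 * 1\<^sup>2 + 3\<^sup>2 = 3 * 2\<^sup>2\<close>, and the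
     terms in \<open>v\<close> cancel since \<open>3 * 1 = 3\<close>.\<close>
  have E: "E 1 v ^ 3 * E 3 (- v) = E 2 0 ^ 3" for v
    unfolding E_def exp_of_nat_mult[symmetric] exp_add[symmetric]
    by (rule arg_cong[of _ _ exp]) (simp add: field_simps power2_eq_square)
  have "theta_char \<epsilon> \<epsilon>' u \<tau> ^ 3 * theta_char (3 * \<epsilon> - 2) (3 * \<epsilon>' - 2) (- u) \<tau>
       - theta_char \<epsilon> \<epsilon>' (- u) \<tau> ^ 3 * theta_char (3 * \<epsilon> - 2) (3 * \<epsilon>' - 2) u \<tau>
     = (E 1 u ^ 3 * E 3 (- u)) * (\<theta> (p + u) ^ 3 * \<theta> (3 * p - u))
       - (E 1 (- u) ^ 3 * E 3 (- (- u))) * (\<theta> (p - u) ^ 3 * \<theta> (3 * p + u))"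
    unfolding e1 e3 by (simp add: power_mult_distrib)
  also have "\<dots> = E 2 0 ^ 3 * (\<theta> (p + u) ^ 3 * \<theta> (3 * p - u) - \<theta> (p - u) ^ 3 * \<theta> (3 * p + u))"
    unfolding E by (simp add: right_diff_distrib)
  also have "\<dots> = E 2 0 ^ 3 * (\<theta> (2 * u) * \<theta> (2 * p) ^ 3)"
    unfolding \<theta>_def theta_1_1_triplication[OF \<tau>] ..
  also have "\<dots> = theta_char 1 1 (2 * u) \<tau> * theta_char (2 * \<epsilon> - 1) (2 * \<epsilon>' - 1) 0 \<tau> ^ 3"
    unfolding e2 by (simp add: \<theta>_def power_mult_distrib)
  finally show ?thesis .
qed

section \<open>Derivatives at the origin\<close>

text \<open>
  The derivative of the triplication formula at \<open>u = 0\<close>. It is a form of the identity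
  \<open>3 \<phi> p - \<phi> (3 p) = \<theta>' 0 * \<theta> (2 p) ^ 3 / (\<theta> p ^ 3 * \<theta> (3 p))\<close> for the logarithmic
  derivative \<open>\<phi>\<close> of \<open>\<theta> = theta_char 1 1\<close>, cleared of denominators.
\<close>

lemma theta_deriv_const_relation:
  assumes \<tau>: "Im \<tau> > 0"
  shows "3 * theta_const \<epsilon> \<epsilon>' \<tau> ^ 2 * theta_deriv_const \<epsilon> \<epsilon>' \<tau> * theta_const (3 * \<epsilon> - 2) (3 * \<epsilon>' - 2) \<tau>
       - theta_const \<epsilon> \<epsilon>' \<tau> ^ 3 * theta_deriv_const (3 * \<epsilon> - 2) (3 * \<epsilon>' - 2) \<tau>
       = theta_deriv_const 1 1 \<tau> * theta_const (2 * \<epsilon> - 1) (2 * \<epsilon>' - 1) \<tau> ^ 3"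
proof -
  define f g h where "f u = theta_char \<epsilon> \<epsilon>' u \<tau>"
    and "g u = theta_char (3 * \<epsilon> - 2) (3 * \<epsilon>' - 2) u \<tau>"
    and "h u = theta_char 1 1 u \<tau>" for u
  define f' g' h' where "f' = theta_deriv_const \<epsilon> \<epsilon>' \<tau>"
    and "g' = theta_deriv_const (3 * \<epsilon> - 2) (3 * \<epsilon>' - 2) \<tau>"
    and "h' = theta_deriv_const 1 1 \<tau>"
  define c where "c = theta_const (2 * \<epsilon> - 1) (2 * \<epsilon>' - 1) \<tau>"
  have D: "(f has_field_derivative f') (at 0)" "(g has_field_derivative g') (at 0)"
    "(h has_field_derivative h') (at 0)"
    unfolding f_def g_def h_def f'_def g'_def h'_def
    by (rule has_field_derivative_theta_char[OF \<tau>])+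
  have comp: "((\<lambda>u. k (m * u)) has_field_derivative k' * m) (at 0)"
    if "(k has_field_derivative k') (at 0)" for k k' and m :: complex
    using DERIV_chain2[of k k' "\<lambda>u. m * u" 0 m UNIV] that
    by (auto intro!: derivative_eq_intros)
  have neg: "((\<lambda>u. k (- u)) has_field_derivative - k') (at 0)"
    if "(k has_field_derivative k') (at 0)" for k :: "complex \<Rightarrow> complex" and k'
    using comp[OF that, of "- 1"] by simp
  have L: "((\<lambda>u. f u ^ 3 * g (- u) - f (- u) ^ 3 * g u) has_field_derivative
      2 * (3 * f 0 ^ 2 * f' * g 0 - f 0 ^ 3 * g')) (at 0)"
    by (rule derivative_eq_intros D neg[OF D(1)] neg[OF D(2)] refl)+ (simp add: algebra_simps)
  have R: "((\<lambda>u. h (2 * u) * c ^ 3) has_field_derivative 2 * (h' * c ^ 3)) (at 0)"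
    using DERIV_cmult_right[OF comp[OF D(3), of 2], of "c ^ 3"] by (simp add: mult_ac)
  have "(\<lambda>u. f u ^ 3 * g (- u) - f (- u) ^ 3 * g u) = (\<lambda>u. h (2 * u) * c ^ 3)"
    unfolding f_def g_def h_def c_def theta_const_def theta_char_triplication[OF \<tau>] ..
  with L R have "2 * (3 * f 0 ^ 2 * f' * g 0 - f 0 ^ 3 * g') = 2 * (h' * c ^ 3)"
    using DERIV_unique by metis
  then have "3 * f 0 ^ 2 * f' * g 0 - f 0 ^ 3 * g' = h' * c ^ 3"
    unfolding mult_cancel_left by simp
  then show ?thesis
    by (simp add: f_def g_def f'_def g'_def h'_def c_def theta_const_def)
qed

lemma theta_deriv_const_0_1:
  assumes \<tau>: "Im \<tau> > 0"
  shows "theta_deriv_const 0 1 \<tau> = 0"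
proof -
  define f where "f u = theta_char 0 1 u \<tau>" for u
  have even: "f (- u) = f u" for u
    using theta_char_add_2_right[of 0 "- 1" u \<tau>] by (simp add: f_def theta_char_uminus)
  have D: "(f has_field_derivative theta_deriv_const 0 1 \<tau>) (at 0)"
    unfolding f_def by (rule has_field_derivative_theta_char[OF \<tau>])
  have "((\<lambda>u. f (- u)) has_field_derivative theta_deriv_const 0 1 \<tau> * - 1) (at 0)"
    using D by (intro DERIV_chain2[of f _ uminus]) (auto intro!: derivative_eq_intros)
  with D have "theta_deriv_const 0 1 \<tau> = theta_deriv_const 0 1 \<tau> * - 1"
    unfolding even by (rule DERIV_unique)
  then show ?thesis by simp
qed

text \<open>
  Up to a nonzero factor this is the value of \<open>theta_char 0 1\<close> at a point with imaginary part
  \<open>Im \<tau> / 3\<close>, inside the zero-free strip.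
\<close>

lemma theta_const_two_thirds_nonzero:
  assumes \<tau>: "Im \<tau> > 0"
  shows "theta_const (2 / 3) \<epsilon>' \<tau> \<noteq> 0"
proof -
  have "theta_char 0 1 (of_real (\<epsilon>' - 1) / 2 + of_real (1 / 3) * \<tau>) \<tau> \<noteq> 0"
    by (rule theta_char_0_1_nonzero[OF \<tau>]) (use \<tau> in simp)
  then show ?thesis
    using theta_char_shift[of 0 "1 / 3" 1 "\<epsilon>' - 1" 0 \<tau>] by (simp add: theta_const_def)
qed

text \<open>
  At \<open>\<epsilon> = 2 / 3\<close> the triple point has first characteristic \<open>0\<close>. If its second characteristic is
  equivalent to \<open>1\<close>, its theta function is even, and the term with \<open>\<theta>'\<close> at the triple point drops
  out of the derivative relation.
\<close>

lemma theta_deriv_const_two_thirds: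
  assumes \<tau>: "Im \<tau> > 0"
    and third: "\<And>\<zeta>. theta_char 0 (3 * \<epsilon>' - 2) \<zeta> \<tau> = theta_char 0 1 \<zeta> \<tau>"
  shows "theta_deriv_const (2 / 3) \<epsilon>' \<tau> =
      1 / 3 * (theta_deriv_const 1 1 \<tau> * theta_const (1 / 3) (2 * \<epsilon>' - 1) \<tau> ^ 3
        / (theta_const (2 / 3) \<epsilon>' \<tau> ^ 2 * theta_const 0 1 \<tau>))"
proof -
  have "theta_const 0 (3 * \<epsilon>' - 2) \<tau> = theta_const 0 1 \<tau>"
    "theta_deriv_const 0 (3 * \<epsilon>' - 2) \<tau> = 0"
    using theta_deriv_const_0_1[OF \<tau>] by (simp_all add: theta_const_def theta_deriv_const_def third)
  then have "3 * theta_const (2 / 3) \<epsilon>' \<tau> ^ 2 * theta_deriv_const (2 / 3) \<epsilon>' \<tau> * theta_const 0 1 \<tau>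
      = theta_deriv_const 1 1 \<tau> * theta_const (1 / 3) (2 * \<epsilon>' - 1) \<tau> ^ 3"
    using theta_deriv_const_relation[OF \<tau>, of "2 / 3" \<epsilon>'] by simp
  moreover have "theta_const 0 1 \<tau> \<noteq> 0"
    using theta_char_0_1_nonzero[OF \<tau>, of 0] \<tau> by (simp add: theta_const_def)
  moreover note theta_const_two_thirds_nonzero[OF \<tau>, of \<epsilon>']
  ultimately show ?thesis by (simp add: field_simps)
qed

lemma theta_const_third_cube:
  "theta_const (1 / 3) (\<epsilon>' + 2) \<tau> ^ 3 = - (theta_const (1 / 3) \<epsilon>' \<tau> ^ 3)"
proof -
  have "exp (of_real (pi * (1 / 3)) * \<i>) ^ 3 = exp (of_real pi * \<i>)"
    unfolding exp_of_nat_mult[symmetric] by simp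
  then show ?thesis
    by (simp add: theta_const_def theta_char_add_2_right power_mult_distrib)
qed

theorem theorem5p8:
  fixes \<tau> :: complex
  assumes "Im \<tau> > 0"
  shows "theta_deriv_const (2/3) (1/3) \<tau> =
           - (1/3) * (theta_deriv_const 1 1 \<tau> * theta_const (1/3) (5/3) \<tau> ^ 3
             / (theta_const (2/3) (1/3) \<tau> ^ 2 * theta_const 0 1 \<tau>))
       \<and> theta_deriv_const (2/3) (5/3) \<tau> =
           - (1/3) * (theta_deriv_const 1 1 \<tau> * theta_const (1/3) (1/3) \<tau> ^ 3
             / (theta_const (2/3) (5/3) \<tau> ^ 2 * theta_const 0 1 \<tau>))"
proof
  \<comment> \<open>Here the double point has characteristic \<open>(1/3, - 1/3)\<close>; adding 2 to the second entry flips
     the sign of the cube.\<close>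
  have "theta_char 0 (3 * (1/3) - 2) \<zeta> \<tau> = theta_char 0 1 \<zeta> \<tau>" for \<zeta>
    using theta_char_add_2_right[of 0 "- 1" \<zeta> \<tau>] by simp
  from theta_deriv_const_two_thirds[OF assms this]
  show "theta_deriv_const (2/3) (1/3) \<tau> =
           - (1/3) * (theta_deriv_const 1 1 \<tau> * theta_const (1/3) (5/3) \<tau> ^ 3
             / (theta_const (2/3) (1/3) \<tau> ^ 2 * theta_const 0 1 \<tau>))"
    using theta_const_third_cube[of "- 1/3" \<tau>] by simp
  \<comment> \<open>Here the double point has characteristic \<open>(1/3, 7/3)\<close>, which again differs by 2.\<close>
  have "theta_char 0 (3 * (5/3) - 2) \<zeta> \<tau> = theta_char 0 1 \<zeta> \<tau>" for \<zeta>
    using theta_char_add_2_right[of 0 1 \<zeta> \<tau>] by simp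
  from theta_deriv_const_two_thirds[OF assms this]
  show "theta_deriv_const (2/3) (5/3) \<tau> =
           - (1/3) * (theta_deriv_const 1 1 \<tau> * theta_const (1/3) (1/3) \<tau> ^ 3
             / (theta_const (2/3) (5/3) \<tau> ^ 2 * theta_const 0 1 \<tau>))"
    using theta_const_third_cube[of "1/3" \<tau>] by simp
qed

end
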